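(* For every primitive recursive function $f:\mathbb{N}^n\to\mathbb{N}$ there is a term $M_f$ such that $\vdash M_f:\mathbb{U}^0\multimap^n\mathbb{U}^0$ is derivable in $\mathsf{H}(\emptyset)$ and $M_f$ represents $f$, i.e. $M_f\,\ulcorner m_1\urcorner\cdots\ulcorner m_n\urcorner\leadsto^*\ulcorner f(m_1,\dots,m_n)\urcorner$ for all $m_1,\dots,m_n\in\mathbb{N}$.
   Context: Free algebras: a free algebra $\mathbb{A}=(\mathcal{C}_\mathbb{A},\mathcal{R}_\mathbb{A})$: finite constructor set $\{c^\mathbb{A}_1,\dots,c^\mathbb{A}_{k(\mathbb{A})}\}$ with arities. $\mathscr{A}$ is a fixed finite family of free algebras with pairwise disjoint constructor sets containing: $\mathbb{U}$ ($c_1^\mathbb{U}$ unary, $c_2^\mathbb{U}$ nullary), $\mathbb{B}$ ($c_1^\mathbb{B},c_2^\mathbb{B}$ unary, $c_3^\mathbb{B}$ nullary), $\mathbb{C}$ ($c_1^\mathbb{C}$ binary, $c_2^\mathbb{C}$ nullary), $\mathbb{D}$ ($c_1^\mathbb{D},c_2^\mathbb{D}$ binary, $c_3^\mathbb{D}$ nullary). Numerals: $\ulcorner 0\urcorner=c_2^\mathbb{U}$, $\ulcorner n+1\urcorner=c_1^\mathbb{U}\ulcorner n\urcorner$. Terms: $M::=x\mid c\mid MM\mid \lambda x.M\mid M\{\!\{M,\dots,M\}\!\}\mid M\langle\!\langle M,\dots,M\rangle\!\rangle$. Types: $A::=\mathbb{A}^n\mid A\multimap A$. $A\multimap^0B=B$,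 $A\multimap^{n+1}B=A\multimap(A\multimap^nB)$. Typing rules: (A) $x:A\vdash x:A$; (W) from $\Gamma\vdash M:B$ infer $\Gamma,x:A\vdash M:B$; (C) from $\Gamma,x:A,y:A\vdash M:B$ infer $\Gamma,z:A\vdash M\{z/x,z/y\}:B$; ($I_\multimap$) from $\Gamma,x:A\vdash M:B$ infer $\Gamma\vdash\lambda x.M:A\multimap B$; ($E_\multimap$) from $\Gamma\vdash M:A\multimap B$, $\Delta\vdash N:A$ infer $\Gamma,\Delta\vdash MN:B$; ($I_\mathbb{A}$) $\vdash c:\mathbb{A}^n\multimap^{\mathcal{R}(c)}\mathbb{A}^n$; ($E^C_\mathbb{A}$) from $\Gamma_i\vdash M_{c^\mathbb{A}_i}:\mathbb{A}^m\multimap^{\mathcal{R}(c^\mathbb{A}_i)}C$ and $\Delta\vdash L:\mathbb{A}^m$ infer $\Gamma_1,\dots,\Gamma_{k(\mathbb{A})},\Delta\vdash L\{\!\{M_{c_1^\mathbb{A}},\dots\}\!\}:C$; ($E^R_\mathbb{A}$) from $\Gamma_i\vdash M_{c^\mathbb{A}_i}:\mathbb{A}^m\multimap^{\mathcal{R}(c^\mathbb{A}_i)}(C\multimap^{\mathcal{R}(c^\mathbb{A}_i)}C)$ and $\Delta\vdash L:\mathbb{A}^m$ infer $\Gamma_1,\dots,\Gamma_{k(\mathbb{A})},\Delta\vdash L\langle\!\langle M_{c_1^\mathbb{A}},\dots\rangle\!\rangle:C$. The system $\mathsf{H}(\emptyset)$ uses these rules but never allows rule (C), and requires all contexts $\Gamma_i$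 in rule $E^R_\mathbb{A}$ to be empty. Values $V::=x\mid\lambda x.M\mid T$, $T::=c\mid TT$. Reduction $\to$: $(\lambda x.M)V\to M\{V/x\}$; $c_i^\mathbb{A}t_1\cdots t_r\{\!\{M_{c_1},\dots,M_{c_k}\}\!\}\to M_{c_i}t_1\cdots t_r$; $c_i^\mathbb{A}t_1\cdots t_r\langle\!\langle\vec M\rangle\!\rangle\to M_{c_i}t_1\cdots t_r(t_1\langle\!\langle\vec M\rangle\!\rangle)\cdots(t_r\langle\!\langle\vec M\rangle\!\rangle)$ with $r=\mathcal{R}(c_i^\mathbb{A})$, $t_j$ constructor terms. $\leadsto$ is the closure of $\to$ under application contexts on both sides and under the scrutinee position of conditionals/recursions (not under $\lambda$, not inside branches); $\leadsto^*$ its reflexive-transitive closure. *)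

theory Defs
  imports Main
begin

section \<open>Families of free algebras\<close>

text \<open>
  A finite family of free algebras is indexed by a finite type \<open>'a\<close>. The list \<open>constrs A\<close>
  enumerates the constructors of \<open>A\<close>, so that the constructor with (one-based) number
  \<open>i + 1\<close> is \<open>constrs A ! i\<close>. The constructor sets are pairwise disjoint, hence a single
  arity function serves all algebras. The type \<open>'c\<close> consists of the constructors of the
  family and nothing else.
\<close>

definition free_algebra_family ::
    "('a::finite \<Rightarrow> 'c list) \<Rightarrow> ('c \<Rightarrow> nat) \<Rightarrow> 'a \<Rightarrow> 'a \<Rightarrow> 'a \<Rightarrow> 'a \<Rightarrow> bool" where
  "free_algebra_family constrs arity U B C D \<longleftrightarrow>
     (\<forall>A. distinct (constrs A)) \<and>
     (\<forall>A A'. A \<noteq> A' \<longrightarrow> set (constrs A) \<inter> set (constrs A') = {}) \<and>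
     (\<Union>A. set (constrs A)) = UNIV \<and>
     map arity (constrs U) = [1, 0] \<and>
     map arity (constrs B) = [1, 1, 0] \<and>
     map arity (constrs C) = [2, 0] \<and>
     map arity (constrs D) = [2, 2, 0]"


section \<open>Terms\<close>

text \<open>
  Terms modulo \<open>\<alpha>\<close>-conversion, in de Bruijn notation. \<open>Cond L Ms\<close> is
  \<open>L{{Ms}}\<close> and \<open>Rec L Ms\<close> is \<open>L<<Ms>>\<close>; neither binds variables.
\<close>

datatype 'c trm =
    Var nat
  | Con 'c
  | App "'c trm" "'c trm"
  | Lam "'c trm"
  | Cond "'c trm" "'c trm list"
  | Rec "'c trm" "'c trm list"

abbreviation apps :: "'c trm \<Rightarrow> 'c trm list \<Rightarrow> 'c trm" where
  "apps \<equiv> foldl App"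

fun lift :: "nat \<Rightarrow> 'c trm \<Rightarrow> 'c trm" where
  "lift k (Var i) = (if i < k then Var i else Var (Suc i))"
| "lift k (Con c) = Con c"
| "lift k (App M N) = App (lift k M) (lift k N)"
| "lift k (Lam M) = Lam (lift (Suc k) M)"
| "lift k (Cond L Ms) = Cond (lift k L) (map (lift k) Ms)"
| "lift k (Rec L Ms) = Rec (lift k L) (map (lift k) Ms)"

text \<open>\<open>subst k N M\<close> replaces index \<open>k\<close> of \<open>M\<close> by \<open>N\<close> and decrements the indices above \<open>k\<close>.\<close>

fun subst :: "nat \<Rightarrow> 'c trm \<Rightarrow> 'c trm \<Rightarrow> 'c trm" where
  "subst k N (Var i) = (if i < k then Var i else if i = k then N else Var (i - 1))"
| "subst k N (Con c) = Con c"
| "subst k N (App M M') = App (subst k N M) (subst k N M')"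
| "subst k N (Lam M) = Lam (subst (Suc k) (lift 0 N) M)"
| "subst k N (Cond L Ms) = Cond (subst k N L) (map (subst k N) Ms)"
| "subst k N (Rec L Ms) = Rec (subst k N L) (map (subst k N) Ms)"


section \<open>The type system H(\<open>\<emptyset>\<close>)\<close>

datatype 'a ty = Base 'a nat | Lolli "'a ty" "'a ty"  (infixr "\<multimap>" 70)

fun lollis :: "'a ty \<Rightarrow> nat \<Rightarrow> 'a ty \<Rightarrow> 'a ty" where
  "lollis A 0 B = B"
| "lollis A (Suc n) B = (A \<multimap> lollis A n B)"

text \<open>
  A context maps the free indices it declares to their types. Juxtaposition of contexts is
  only defined when the declared variables are disjoint.
\<close>

type_synonym 'a ctx = "nat \<rightharpoonup> 'a ty"

definition disjoint_ctxs :: "'a ctx list \<Rightarrow> bool" where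
  "disjoint_ctxs \<Gamma>s \<longleftrightarrow>
     (\<forall>i < length \<Gamma>s. \<forall>j < length \<Gamma>s. i \<noteq> j \<longrightarrow> dom (\<Gamma>s ! i) \<inter> dom (\<Gamma>s ! j) = {})"

definition join_ctxs :: "'a ctx list \<Rightarrow> 'a ctx" where
  "join_ctxs \<Gamma>s = foldr (++) \<Gamma>s Map.empty"

text \<open>
  There is no contraction rule, and the branches of a recursion are typed in the empty
  context. In rule \<open>abs\<close> the bound variable is index \<open>0\<close> of the body.
\<close>

inductive H_empty ::
    "('a \<Rightarrow> 'c list) \<Rightarrow> ('c \<Rightarrow> nat) \<Rightarrow> 'a ctx \<Rightarrow> 'c trm \<Rightarrow> 'a ty \<Rightarrow> bool"
  for constrs :: "'a \<Rightarrow> 'c list" and arity :: "'c \<Rightarrow> nat" where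
  ax: "H_empty constrs arity [x \<mapsto> A] (Var x) A"
| weak: "H_empty constrs arity \<Gamma> M B \<Longrightarrow> x \<notin> dom \<Gamma> \<Longrightarrow>
    H_empty constrs arity (\<Gamma>(x \<mapsto> A)) M B"
| abs: "H_empty constrs arity (case_nat (Some A) \<Gamma>) M B \<Longrightarrow>
    H_empty constrs arity \<Gamma> (Lam M) (A \<multimap> B)"
| app: "H_empty constrs arity \<Gamma> M (A \<multimap> B) \<Longrightarrow> H_empty constrs arity \<Delta> N A \<Longrightarrow>
    disjoint_ctxs [\<Gamma>, \<Delta>] \<Longrightarrow>
    H_empty constrs arity (join_ctxs [\<Gamma>, \<Delta>]) (App M N) B"
| con: "c \<in> set (constrs A) \<Longrightarrow>
    H_empty constrs arity Map.empty (Con c) (lollis (Base A n) (arity c) (Base A n))"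
| cond: "length Ms = length (constrs A) \<Longrightarrow> length \<Gamma>s = length (constrs A) \<Longrightarrow>
    (\<forall>i < length (constrs A).
       H_empty constrs arity (\<Gamma>s ! i) (Ms ! i) (lollis (Base A m) (arity (constrs A ! i)) C)) \<Longrightarrow>
    H_empty constrs arity \<Delta> L (Base A m) \<Longrightarrow>
    disjoint_ctxs (\<Gamma>s @ [\<Delta>]) \<Longrightarrow>
    H_empty constrs arity (join_ctxs (\<Gamma>s @ [\<Delta>])) (Cond L Ms) C"
| recur: "length Ms = length (constrs A) \<Longrightarrow>
    (\<forall>i < length (constrs A).
       H_empty constrs arity Map.empty (Ms ! i)
         (lollis (Base A m) (arity (constrs A ! i)) (lollis C (arity (constrs A ! i)) C))) \<Longrightarrow>
    H_empty constrs arity \<Delta> L (Base A m) \<Longrightarrow>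
    H_empty constrs arity \<Delta> (Rec L Ms) C"


section \<open>Reduction\<close>

inductive constructor_term :: "'c trm \<Rightarrow> bool" where
  "constructor_term (Con c)"
| "constructor_term T \<Longrightarrow> constructor_term T' \<Longrightarrow> constructor_term (App T T')"

inductive is_value :: "'c trm \<Rightarrow> bool" where
  "is_value (Var x)"
| "is_value (Lam M)"
| "constructor_term T \<Longrightarrow> is_value T"

inductive contracts ::
    "('a \<Rightarrow> 'c list) \<Rightarrow> ('c \<Rightarrow> nat) \<Rightarrow> 'c trm \<Rightarrow> 'c trm \<Rightarrow> bool"
  for constrs :: "'a \<Rightarrow> 'c list" and arity :: "'c \<Rightarrow> nat" where
  beta: "is_value V \<Longrightarrow> contracts constrs arity (App (Lam M) V) (subst 0 V M)"
| cond: "i < length (constrs A) \<Longrightarrow> length Ms = length (constrs A) \<Longrightarrow>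
    length ts = arity (constrs A ! i) \<Longrightarrow> \<forall>t \<in> set ts. constructor_term t \<Longrightarrow>
    contracts constrs arity
      (Cond (apps (Con (constrs A ! i)) ts) Ms)
      (apps (Ms ! i) ts)"
| recur: "i < length (constrs A) \<Longrightarrow> length Ms = length (constrs A) \<Longrightarrow>
    length ts = arity (constrs A ! i) \<Longrightarrow> \<forall>t \<in> set ts. constructor_term t \<Longrightarrow>
    contracts constrs arity
      (Rec (apps (Con (constrs A ! i)) ts) Ms)
      (apps (Ms ! i) (ts @ map (\<lambda>t. Rec t Ms) ts))"

inductive reduces ::
    "('a \<Rightarrow> 'c list) \<Rightarrow> ('c \<Rightarrow> nat) \<Rightarrow> 'c trm \<Rightarrow> 'c trm \<Rightarrow> bool"
  for constrs :: "'a \<Rightarrow> 'c list" and arity :: "'c \<Rightarrow> nat" where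
  contract: "contracts constrs arity M N \<Longrightarrow> reduces constrs arity M N"
| app_left: "reduces constrs arity M M' \<Longrightarrow> reduces constrs arity (App M N) (App M' N)"
| app_right: "reduces constrs arity N N' \<Longrightarrow> reduces constrs arity (App M N) (App M N')"
| cond: "reduces constrs arity L L' \<Longrightarrow> reduces constrs arity (Cond L Ms) (Cond L' Ms)"
| recur: "reduces constrs arity L L' \<Longrightarrow> reduces constrs arity (Rec L Ms) (Rec L' Ms)"


section \<open>Primitive recursive functions and their representation\<close>

text \<open>
  An \<open>n\<close>-ary function on the natural numbers is a function on lists of which only the values
  at lists of length \<open>n\<close> matter; rule \<open>ext\<close> makes the notion insensitive to the other
  values. Recursion is on the first argument.
\<close>

inductive prim_recursive :: "nat \<Rightarrow> (nat list \<Rightarrow> nat) \<Rightarrow> bool" where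
  zero: "prim_recursive n (\<lambda>xs. 0)"
| succ: "prim_recursive 1 (\<lambda>xs. Suc (xs ! 0))"
| proj: "i < n \<Longrightarrow> prim_recursive n (\<lambda>xs. xs ! i)"
| comp: "prim_recursive (length gs) f \<Longrightarrow> \<forall>g \<in> set gs. prim_recursive n g \<Longrightarrow>
    prim_recursive n (\<lambda>xs. f (map (\<lambda>g. g xs) gs))"
| prec: "prim_recursive n g \<Longrightarrow> prim_recursive (Suc (Suc n)) h \<Longrightarrow>
    prim_recursive (Suc n)
      (\<lambda>xs. rec_nat (g (tl xs)) (\<lambda>y r. h (y # r # tl xs)) (hd xs))"
| ext: "prim_recursive n f \<Longrightarrow> (\<And>xs. length xs = n \<Longrightarrow> f' xs = f xs) \<Longrightarrow> prim_recursive n f'"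

fun unary_numeral :: "('a \<Rightarrow> 'c list) \<Rightarrow> 'a \<Rightarrow> nat \<Rightarrow> 'c trm" where
  "unary_numeral constrs U 0 = Con (constrs U ! 1)"
| "unary_numeral constrs U (Suc n) = App (Con (constrs U ! 0)) (unary_numeral constrs U n)"

definition represents ::
    "('a \<Rightarrow> 'c list) \<Rightarrow> ('c \<Rightarrow> nat) \<Rightarrow> 'a \<Rightarrow> 'c trm \<Rightarrow> nat \<Rightarrow> (nat list \<Rightarrow> nat) \<Rightarrow> bool" where
  "represents constrs arity U M n f \<longleftrightarrow>
     (\<forall>ms. length ms = n \<longrightarrow>
       (reduces constrs arity)\<^sup>*\<^sup>*
         (apps M (map (unary_numeral constrs U) ms))
         (unary_numeral constrs U (f ms)))"

end

theory Submission
  imports Defs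
begin

text \<open>
  Natural numbers and lists of them are coded as binary trees of the algebra \<open>C\<close>, so that
  every function becomes a closed program of type \<open>T \<multimap> T\<close> with \<open>T = C\<^sup>0\<close>. Nonlinear use of
  an argument, as in composition and primitive recursion, is possible because a tree can be
  duplicated by a recursion at a higher type whose branches are closed and linear. Primitive
  recursion is a recursion with result type \<open>T \<multimap> T\<close>, in which the parameters are passed
  to the recursive call after having been duplicated. A curried front end on unary numerals
  builds the list of arguments and decodes the result.
\<close>

section \<open>Free variables and syntax-directed typing\<close>

fun fv :: "'c trm \<Rightarrow> nat set" where
  "fv (Var i) = {i}"
| "fv (Con c) = {}"
| "fv (App M N) = fv M \<union> fv N"
| "fv (Lam M) = (\<lambda>i. i - 1) ` (fv M - {0})"
| "fv (Cond L Ms) = fv L \<union> \<Union> (set (map fv Ms))"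
| "fv (Rec L Ms) = fv L \<union> \<Union> (set (map fv Ms))"

text \<open>\<open>fv\<close> of an abstraction involves a set difference; this rule evaluates it on
  the explicit index sets of the concrete programs.\<close>

declare insert_Diff_if [simp]

lemma mem_fv_Lam: "i \<in> fv (Lam M) \<longleftrightarrow> Suc i \<in> fv M"
  by (auto simp: image_iff intro!: bexI[of _ "Suc i"]) (metis Suc_pred neq0_conv)

lemma fv_Lam_bound: "fv (Lam M) \<subseteq> {..<k} \<longleftrightarrow> fv M \<subseteq> {..<Suc k}"
proof -
  have "fv M \<subseteq> {..<Suc k}" if "fv (Lam M) \<subseteq> {..<k}"
  proof
    fix i assume "i \<in> fv M"
    with that show "i \<in> {..<Suc k}"
      using mem_fv_Lam[of "i - 1" M] by (cases i) (auto simp del: fv.simps)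
  qed
  moreover have "fv (Lam M) \<subseteq> {..<k}" if "fv M \<subseteq> {..<Suc k}"
    using that mem_fv_Lam[of _ M] by (auto simp del: fv.simps)
  ultimately show ?thesis by blast
qed

text \<open>Bounding the free indices by \<open>k\<close>, instead of assuming closedness, lets the
  induction pass under \<open>Lam\<close>, where the bound becomes \<open>Suc k\<close>.\<close>

lemma lift_fv_bound: "fv M \<subseteq> {..<k} \<Longrightarrow> lift k M = M"
proof (induction k M rule: lift.induct)
  case (4 k M)
  then show ?case by (simp add: fv_Lam_bound del: fv.simps)
qed (auto intro!: map_idI)

lemma subst_fv_bound: "fv M \<subseteq> {..<k} \<Longrightarrow> subst k N M = M"
proof (induction k N M rule: subst.induct)
  case (4 k N M)
  then show ?case by (simp add: fv_Lam_bound del: fv.simps)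
qed (auto intro!: map_idI)

lemma lift_closed [simp]: "fv M = {} \<Longrightarrow> lift k M = M"
  by (simp add: lift_fv_bound)

lemma subst_closed [simp]: "fv M = {} \<Longrightarrow> subst k N M = M"
  by (simp add: subst_fv_bound)

section \<open>Typing in contexts cut down to the free variables\<close>

definition ctx_on :: "'a ty list \<Rightarrow> nat set \<Rightarrow> 'a ctx" where
  "ctx_on E X = (\<lambda>i. if i \<in> X then Some (E ! i) else None)"

lemma dom_ctx_on [simp]: "dom (ctx_on E X) = X"
  by (auto simp: ctx_on_def split: if_splits)

lemma ctx_on_empty [simp]: "ctx_on E {} = Map.empty"
  by (simp add: ctx_on_def)

text \<open>Both contexts read their types off the same list \<open>E\<close>, so where they overlap
  they agree, whichever of them \<open>++\<close> prefers.\<close>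

lemma join_ctx_on: "join_ctxs [ctx_on E X, ctx_on E Y] = ctx_on E (X \<union> Y)"
  by (auto simp: join_ctxs_def ctx_on_def map_add_def fun_eq_iff split: option.splits)

text \<open>This is the context of a conditional with closed branches: only the part belonging to
  the scrutinee remains.\<close>

lemma join_replicate_empty: "join_ctxs (replicate k Map.empty @ [\<Delta>]) = \<Delta>"
  by (induction k) (auto simp: join_ctxs_def)

lemma disjoint_replicate_empty: "disjoint_ctxs (replicate k Map.empty @ [\<Delta>])"
  by (auto simp: disjoint_ctxs_def nth_append)

text \<open>
  Restricting the context to the free variables makes the splitting of contexts in the
  application rule, and the use of weakening, implicit.
\<close>

definition typed ::
    "('a \<Rightarrow> 'c list) \<Rightarrow> ('c \<Rightarrow> nat) \<Rightarrow> 'a ty list \<Rightarrow> 'c trm \<Rightarrow> 'a ty \<Rightarrow> bool" where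
  "typed constrs arity E M A \<longleftrightarrow>
     fv M \<subseteq> {..<length E} \<and> H_empty constrs arity (ctx_on E (fv M)) M A"

lemma typed_Nil_iff:
  "typed constrs arity [] M A \<longleftrightarrow> fv M = {} \<and> H_empty constrs arity Map.empty M A"
  by (auto simp: typed_def)

lemma typed_closed: "typed constrs arity [] M A \<Longrightarrow> typed constrs arity E M A"
  by (auto simp: typed_def)

lemma typed_Var_0: "typed constrs arity (A # E) (Var 0) A"
proof -
  have "ctx_on (A # E) {0} = [0 \<mapsto> A]" by (auto simp: ctx_on_def)
  then show ?thesis by (auto simp: typed_def intro: H_empty.ax)
qed

text \<open>Any derivation for a variable forces the context to give it the derived type, so the
  entry of \<open>E\<close> can be recovered. The step from \<open>x\<close> to \<open>Suc x\<close>
  makes repeated resolution perform the lookup.\<close>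

lemma typed_Var_Suc:
  assumes "typed constrs arity E (Var x) A"
  shows "typed constrs arity (B # E) (Var (Suc x)) A"
proof -
  have "H_empty constrs arity \<Gamma> M A \<Longrightarrow> M = Var x \<Longrightarrow> \<Gamma> x = Some A" for \<Gamma> M
    by (induction rule: H_empty.induct) auto
  with assms have "E ! x = A" "x < length E"
    by (fastforce simp: typed_def ctx_on_def)+
  moreover have "ctx_on (B # E) {Suc x} = [Suc x \<mapsto> E ! x]"
    by (auto simp: ctx_on_def)
  ultimately show ?thesis by (auto simp: typed_def intro: H_empty.ax)
qed

text \<open>The last assumption is linearity: for contexts restricted to free variables it is
  exactly the disjointness demanded by rule \<open>app\<close>.\<close>

lemma typed_App:
  assumes "typed constrs arity E M (A \<multimap> B)" "typed constrs arity E N A" "fv M \<inter> fv N = {}"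
  shows "typed constrs arity E (App M N) B"
proof -
  have "disjoint_ctxs [ctx_on E (fv M), ctx_on E (fv N)]"
    using assms(3) by (auto simp: disjoint_ctxs_def less_Suc_eq)
  with assms show ?thesis
    using H_empty.app[of constrs arity "ctx_on E (fv M)" M A B "ctx_on E (fv N)" N]
    by (auto simp: typed_def join_ctx_on)
qed

text \<open>If index \<open>0\<close> does not occur in \<open>M\<close>, the restricted context
  does not declare it, and the declaration is supplied by weakening.\<close>

lemma typed_Lam:
  assumes "typed constrs arity (A # E) M B"
  shows "typed constrs arity E (Lam M) (A \<multimap> B)"
proof -
  let ?\<Gamma> = "ctx_on (A # E) (fv M)"
  have eq: "case_nat (Some A) (ctx_on E (fv (Lam M))) = ?\<Gamma>(0 \<mapsto> A)"
    by (auto simp: ctx_on_def fun_eq_iff mem_fv_Lam simp del: fv.simps split: nat.splits)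
  have "H_empty constrs arity (?\<Gamma>(0 \<mapsto> A)) M B"
  proof (cases "0 \<in> fv M")
    case True
    then have "?\<Gamma>(0 \<mapsto> A) = ?\<Gamma>" by (auto simp: ctx_on_def)
    with assms show ?thesis by (simp add: typed_def)
  next
    case False
    with assms show ?thesis by (intro H_empty.weak) (auto simp: typed_def)
  qed
  then have "H_empty constrs arity (ctx_on E (fv (Lam M))) (Lam M) (A \<multimap> B)"
    by (intro H_empty.abs) (simp only: eq)
  moreover have "fv (Lam M) \<subseteq> {..<length E}"
    using assms by (simp add: typed_def fv_Lam_bound del: fv.simps)
  ultimately show ?thesis by (simp add: typed_def del: fv.simps)
qed

lemma typed_Cond:
  assumes "typed constrs arity E L (Base A m)" "length Ms = length (constrs A)"
    and "\<And>i. i < length (constrs A) \<Longrightarrow>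
      typed constrs arity [] (Ms ! i) (lollis (Base A m) (arity (constrs A ! i)) B)"
  shows "typed constrs arity E (Cond L Ms) B"
proof -
  have "\<Union> (set (map fv Ms)) = {}"
    using assms(2,3) by (auto simp: typed_def in_set_conv_nth)
  moreover have "H_empty constrs arity (ctx_on E (fv L)) (Cond L Ms) B"
    using H_empty.cond[of Ms constrs A "replicate (length Ms) Map.empty" arity m B "ctx_on E (fv L)" L]
      assms(1,2) assms(3)[unfolded typed_Nil_iff]
    by (simp add: typed_def join_replicate_empty disjoint_replicate_empty)
  ultimately show ?thesis using assms(1) by (simp add: typed_def)
qed

lemma typed_Rec:
  assumes "typed constrs arity E L (Base A m)" "length Ms = length (constrs A)"
    and "\<And>i. i < length (constrs A) \<Longrightarrow> typed constrs arity [] (Ms ! i)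
      (lollis (Base A m) (arity (constrs A ! i)) (lollis B (arity (constrs A ! i)) B))"
  shows "typed constrs arity E (Rec L Ms) B"
proof -
  have "\<Union> (set (map fv Ms)) = {}"
    using assms(2,3) by (auto simp: typed_def in_set_conv_nth)
  moreover have "H_empty constrs arity (ctx_on E (fv L)) (Rec L Ms) B"
    using assms(1,2) assms(3)[unfolded typed_Nil_iff]
    by (intro H_empty.recur) (auto simp: typed_def)
  ultimately show ?thesis using assms(1) by (simp add: typed_def)
qed

lemma typed_Con:
  "c \<in> set (constrs A) \<Longrightarrow>
    typed constrs arity E (Con c) (lollis (Base A n) (arity c) (Base A n))"
  by (simp add: typed_def H_empty.con)


section \<open>Reduction sequences\<close>

abbreviation steps ::
    "('a \<Rightarrow> 'c list) \<Rightarrow> ('c \<Rightarrow> nat) \<Rightarrow> 'c trm \<Rightarrow> 'c trm \<Rightarrow> bool" where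
  "steps constrs arity \<equiv> (reduces constrs arity)\<^sup>*\<^sup>*"

lemma steps_App:
  assumes "steps constrs arity M M'" "steps constrs arity N N'"
  shows "steps constrs arity (App M N) (App M' N')"
proof -
  have "steps constrs arity (App M N) (App M' N)"
    using assms(1) by induction (auto intro: rtranclp.rtrancl_into_rtrancl reduces.app_left)
  also have "steps constrs arity (App M' N) (App M' N')"
    using assms(2) by induction (auto intro: rtranclp.rtrancl_into_rtrancl reduces.app_right)
  finally show ?thesis .
qed

lemma steps_apps:
  "steps constrs arity M M' \<Longrightarrow> steps constrs arity (apps M Ns) (apps M' Ns)"
  by (induction Ns arbitrary: M M') (auto intro: steps_App)

lemma steps_Rec: "steps constrs arity L L' \<Longrightarrow> steps constrs arity (Rec L Ms) (Rec L' Ms)"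
  by (induction rule: rtranclp_induct)
    (auto intro: rtranclp.rtrancl_into_rtrancl reduces.recur)

lemma steps_beta:
  assumes "steps constrs arity M (Lam M')" "steps constrs arity N V" "is_value V"
    and "steps constrs arity (subst 0 V M') W"
  shows "steps constrs arity (App M N) W"
proof -
  have "steps constrs arity (App M N) (App (Lam M') V)"
    using assms(1,2) by (rule steps_App)
  also have "steps constrs arity \<dots> (subst 0 V M')"
    using assms(3) by (intro r_into_rtranclp reduces.contract contracts.beta)
  also note assms(4)
  finally show ?thesis .
qed


section \<open>Binary trees as a uniform data type\<close>

text \<open>The constructors \<open>s\<close> and \<open>z\<close> are successor and zero,
  \<open>p\<close> and \<open>e\<close> the node and the leaf of binary trees.\<close>

locale tree_algebra =
  fixes constrs :: "'a \<Rightarrow> 'c list" and arity :: "'c \<Rightarrow> nat"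
    and U C :: 'a and s z p e :: 'c
  assumes constrs_U: "constrs U = [s, z]" and constrs_C: "constrs C = [p, e]"
    and arity_simps [simp]: "arity s = 1" "arity z = 0" "arity p = 2" "arity e = 0"
begin

abbreviation "N \<equiv> Base U 0"
abbreviation "T \<equiv> Base C 0"
abbreviation "zero \<equiv> Con z"
abbreviation "succ M \<equiv> App (Con s) M"
abbreviation "leaf \<equiv> Con e"
abbreviation "node L M \<equiv> App (App (Con p) L) M"

abbreviation typing :: "'a ty list \<Rightarrow> 'c trm \<Rightarrow> 'a ty \<Rightarrow> bool"  ("_ \<turnstile> _ : _" [51, 51, 51] 50) where
  "E \<turnstile> M : A \<equiv> typed constrs arity E M A"

abbreviation steps_to :: "'c trm \<Rightarrow> 'c trm \<Rightarrow> bool"  (infix "\<leadsto>" 50) where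
  "M \<leadsto> M' \<equiv> steps constrs arity M M'"

lemma typed_zero: "E \<turnstile> zero : N"
  using typed_Con[of z constrs U arity E 0] by (simp add: constrs_U)

lemma typed_leaf: "E \<turnstile> leaf : T"
  using typed_Con[of e constrs C arity E 0] by (simp add: constrs_C)

lemma typed_succ: "E \<turnstile> M : N \<Longrightarrow> E \<turnstile> succ M : N"
  using typed_Con[of s constrs U arity E 0] by (intro typed_App) (auto simp: constrs_U)

lemma typed_node:
  "E \<turnstile> L : T \<Longrightarrow> E \<turnstile> M : T \<Longrightarrow> fv L \<inter> fv M = {} \<Longrightarrow> E \<turnstile> node L M : T"
  using typed_Con[of p constrs C arity E 0]
  by (intro typed_App) (auto simp: constrs_C numeral_2_eq_2)

lemma typed_Rec_unary:
  "E \<turnstile> L : N \<Longrightarrow> [] \<turnstile> M : N \<multimap> A \<multimap> A \<Longrightarrow> [] \<turnstile> M' : A \<Longrightarrow> E \<turnstile> Rec L [M, M'] : A"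
  by (rule typed_Rec[where A = U]) (auto simp: constrs_U less_Suc_eq)

lemma typed_Rec_tree:
  "E \<turnstile> L : T \<Longrightarrow> [] \<turnstile> M : T \<multimap> T \<multimap> A \<multimap> A \<multimap> A \<Longrightarrow> [] \<turnstile> M' : A \<Longrightarrow>
    E \<turnstile> Rec L [M, M'] : A"
  by (rule typed_Rec[where A = C]) (auto simp: constrs_C less_Suc_eq numeral_2_eq_2)

lemma typed_Cond_tree:
  "E \<turnstile> L : T \<Longrightarrow> [] \<turnstile> M : T \<multimap> T \<multimap> A \<Longrightarrow> [] \<turnstile> M' : A \<Longrightarrow> E \<turnstile> Cond L [M, M'] : A"
  by (rule typed_Cond[where A = C]) (auto simp: constrs_C less_Suc_eq numeral_2_eq_2)

text \<open>The order matters: \<open>succ\<close> and \<open>node\<close> terms are applications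
  too and must be recognised before \<open>typed_App\<close>. Linearity conditions are left to
  simplification.\<close>

lemmas typed_rules =
  typed_Var_0 typed_Var_Suc typed_zero typed_leaf typed_succ typed_node
  typed_Rec_unary typed_Rec_tree typed_Cond_tree typed_Lam typed_App

section \<open>Closed trees and their reductions\<close>

inductive tree :: "'c trm \<Rightarrow> bool" where
  tree_leaf [simp]: "tree leaf"
| tree_node [simp]: "tree t \<Longrightarrow> tree u \<Longrightarrow> tree (node t u)"

lemma constructor_term_tree: "tree t \<Longrightarrow> constructor_term t"
  by (induction rule: tree.induct) (auto intro: constructor_term.intros)

lemma is_value_tree [simp]: "tree t \<Longrightarrow> is_value t"
  by (simp add: constructor_term_tree is_value.intros)

lemma fv_tree [simp]: "tree t \<Longrightarrow> fv t = {}"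
  by (induction rule: tree.induct) auto

lemma is_value_Lam [simp]: "is_value (Lam M)"
  by (rule is_value.intros)

lemma steps_Rec_leaf: "Rec leaf [M, M'] \<leadsto> M'"
  using contracts.recur[of 1 constrs C "[M, M']" "[]" arity]
  by (auto simp: constrs_C intro: reduces.contract)

lemma steps_Rec_node:
  "tree t \<Longrightarrow> tree u \<Longrightarrow>
    Rec (node t u) [M, M'] \<leadsto> App (App (App (App M t) u) (Rec t [M, M'])) (Rec u [M, M'])"
  using contracts.recur[of 0 constrs C "[M, M']" "[t, u]" arity]
  by (auto simp: constrs_C constructor_term_tree intro: reduces.contract)

lemma steps_Cond_node: "tree t \<Longrightarrow> tree u \<Longrightarrow> Cond (node t u) [M, M'] \<leadsto> App (App M t) u"
  using contracts.cond[of 0 constrs C "[M, M']" "[t, u]" arity]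
  by (auto simp: constrs_C constructor_term_tree intro: reduces.contract)

lemma steps_Rec_zero: "Rec zero [M, M'] \<leadsto> M'"
  using contracts.recur[of 1 constrs U "[M, M']" "[]" arity]
  by (auto simp: constrs_U intro: reduces.contract)

lemma steps_Rec_succ:
  "constructor_term t \<Longrightarrow> Rec (succ t) [M, M'] \<leadsto> App (App M t) (Rec t [M, M'])"
  using contracts.recur[of 0 constrs U "[M, M']" "[t]" arity]
  by (auto simp: constrs_U intro: reduces.contract)

lemma steps_beta_value:
  "is_value V \<Longrightarrow> subst 0 V M \<leadsto> W \<Longrightarrow> App (Lam M) V \<leadsto> W"
  by (rule steps_beta) auto

text \<open>The first argument is substituted under the second abstraction, hence at index 1; being
  closed, it is unchanged by the lifting this involves.\<close>

lemma steps_beta2: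
  assumes "is_value V" "fv V = {}" "is_value W"
    and "subst 0 W (subst (Suc 0) V M) \<leadsto> R"
  shows "App (App (Lam (Lam M)) V) W \<leadsto> R"
proof (rule steps_beta)
  show "App (Lam (Lam M)) V \<leadsto> Lam (subst (Suc 0) V M)"
    using assms(1,2) by (intro steps_beta_value) auto
qed (use assms in auto)

text \<open>The shape is that of an unfolded tree recursion: two subtrees that are already values,
  then two recursive results still to be evaluated.\<close>

lemma steps_beta4:
  assumes "is_value V1" "fv V1 = {}" "is_value V2" "fv V2 = {}"
    and "L3 \<leadsto> V3" "is_value V3" "fv V3 = {}" "L4 \<leadsto> V4" "is_value V4"
    and "subst 0 V4 (subst 1 V3 (subst 2 V2 (subst 3 V1 M))) \<leadsto> R"
  shows "App (App (App (App (Lam (Lam (Lam (Lam M)))) V1) V2) L3) L4 \<leadsto> R"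
proof (rule steps_beta)
  have "App (App (Lam (Lam (Lam (Lam M)))) V1) V2 \<leadsto> Lam (Lam (subst 2 V2 (subst 3 V1 M)))"
    using assms by (intro steps_beta2) (auto simp: eval_nat_numeral)
  then show "App (App (App (Lam (Lam (Lam (Lam M)))) V1) V2) L3 \<leadsto>
      Lam (subst 1 V3 (subst 2 V2 (subst 3 V1 M)))"
    using assms by (auto intro: steps_beta)
qed (use assms in auto)


subsection \<open>Duplication\<close>

text \<open>
  Contraction is not available, but a tree can be rebuilt twice by structural recursion.
  Since a pair of trees is not a base type, the two copies are handed to a continuation;
  the recursion has result type \<open>(T \<multimap> T \<multimap> T) \<multimap> T\<close>, and its branches are
  closed and linear.
\<close>

definition share :: "'c trm \<Rightarrow> 'c trm \<Rightarrow> 'c trm" where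
  "share L K = App (Rec L
     [Lam (Lam (Lam (Lam (Lam
        (App (Var 2) (Lam (Lam
           (App (Var 3) (Lam (Lam
              (App (App (Var 4) (node (Var 3) (Var 1))) (node (Var 2) (Var 0))))))))))))),
      Lam (App (App (Var 0) leaf) leaf)]) K"

lemma fv_share [simp]: "fv (share L K) = fv L \<union> fv K"
  by (simp add: share_def)

lemma subst_share [simp]: "subst k V (share L K) = share (subst k V L) (subst k V K)"
  by (simp add: share_def)

lemma typed_share:
  assumes "E \<turnstile> L : T" "E \<turnstile> K : T \<multimap> T \<multimap> T" "fv L \<inter> fv K = {}"
  shows "E \<turnstile> share L K : T"
  unfolding share_def
proof (rule typed_App[OF typed_Rec_tree[OF assms(1)] assms(2)], goal_cases)
  case 1
  show ?case
    \<comment> \<open>Indices are brought into successor form, on which \<open>typed_Var_Suc\<close>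
      resolves.\<close>
    unfolding eval_nat_numeral BitM.simps One_nat_def by (rule typed_rules | simp; fail)+
next
  case 2
  show ?case by (rule typed_rules | simp; fail)+
qed (use assms(3) in simp)

lemma steps_share:
  assumes "tree t" "is_value K" "fv K = {}"
  shows "share t K \<leadsto> App (App K t) t"
proof -
  define M where "M = Lam (Lam (Lam (Lam (Lam
        (App (Var 2) (Lam (Lam
           (App (Var 3) (Lam (Lam
              (App (App (Var 4) (node (Var 3) (Var 1))) (node (Var 2) (Var 0)))))))))))))"
  define M' where "M' = Lam (App (App (Var 0) leaf) leaf)"
  \<comment> \<open>Recursive results are evaluated before they are passed on, so the induction
    concerns the value \<open>V\<close> of the recursion and its behaviour at every closed
    continuation that is a value.\<close>
  have "\<exists>V. is_value V \<and> fv V = {} \<and> Rec t [M, M'] \<leadsto> V \<and>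
    (\<forall>K. is_value K \<longrightarrow> fv K = {} \<longrightarrow> App V K \<leadsto> App (App K t) t)"
    using assms(1)
  proof induction
    case tree_leaf
    have "App M' K \<leadsto> App (App K leaf) leaf" if "is_value K" for K
      using that by (auto simp: M'_def intro: steps_beta_value)
    then show ?case
      by (intro exI[of _ M']) (auto simp: M'_def steps_Rec_leaf)
  next
    case (tree_node t u)
    from tree_node.IH obtain V W
      where V: "is_value V" "fv V = {}" "Rec t [M, M'] \<leadsto> V"
        "\<And>K. is_value K \<Longrightarrow> fv K = {} \<Longrightarrow> App V K \<leadsto> App (App K t) t"
      and W: "is_value W" "fv W = {}" "Rec u [M, M'] \<leadsto> W"
        "\<And>K. is_value K \<Longrightarrow> fv K = {} \<Longrightarrow> App W K \<leadsto> App (App K u) u"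
      by blast
    \<comment> \<open>The value of the node branch: it awaits a continuation, obtains two copies of
      \<open>t\<close> from \<open>V\<close> and two of \<open>u\<close> from \<open>W\<close>, and
      builds the node twice.\<close>
    define R where "R = Lam (App V (Lam (Lam
           (App W (Lam (Lam
              (App (App (Var 4) (node (Var 3) (Var 1))) (node (Var 2) (Var 0)))))))))"
    have MR: "App (App (App (App M t) u) L3) L4 \<leadsto> R" if "L3 \<leadsto> V" "L4 \<leadsto> W" for L3 L4
      unfolding M_def R_def using tree_node.hyps V W
      by (intro steps_beta4[OF _ _ _ _ that(1) _ _ that(2)]) auto
    have "Rec (node t u) [M, M'] \<leadsto> App (App (App (App M t) u) (Rec t [M, M'])) (Rec u [M, M'])"
      using tree_node.hyps by (rule steps_Rec_node)
    also have "\<dots> \<leadsto> R"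
      using V W by (intro MR)
    finally have "Rec (node t u) [M, M'] \<leadsto> R" .
    moreover have "App R K \<leadsto> App (App K (node t u)) (node t u)" if K: "is_value K" "fv K = {}" for K
    proof -
      have "App R K \<leadsto> App V (Lam (Lam
           (App W (Lam (Lam
              (App (App K (node (Var 3) (Var 1))) (node (Var 2) (Var 0))))))))"
        unfolding R_def using K V W by (intro steps_beta_value) auto
      \<comment> \<open>Here the hypothesis for \<open>t\<close> is used at a new continuation, the
        one that goes on to duplicate \<open>u\<close>.\<close>
      also have "\<dots> \<leadsto> App (App (Lam (Lam
           (App W (Lam (Lam
              (App (App K (node (Var 3) (Var 1))) (node (Var 2) (Var 0)))))))) t) t"
        using K W by (intro V) (auto simp: image_iff)
      also have "\<dots> \<leadsto> App W (Lam (Lam (App (App K (node t (Var 1))) (node t (Var 0)))))"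
        using tree_node.hyps K W by (intro steps_beta2) auto
      also have "\<dots> \<leadsto> App (App (Lam (Lam (App (App K (node t (Var 1))) (node t (Var 0))))) u) u"
        using tree_node.hyps K by (intro W) auto
      also have "\<dots> \<leadsto> App (App K (node t u)) (node t u)"
        using tree_node.hyps K by (intro steps_beta2) auto
      finally show ?thesis .
    qed
    ultimately show ?case
      using V W by (intro exI[of _ R]) (auto simp: R_def)
  qed
  then obtain V where "Rec t [M, M'] \<leadsto> V" "App V K \<leadsto> App (App K t) t"
    using assms by blast
  then show ?thesis
    unfolding share_def M_def[symmetric] M'_def[symmetric]
    by (meson rtranclp.rtrancl_refl rtranclp_trans steps_App)
qed

lemma steps_share_Lam:
  assumes "tree t" "fv (Lam (Lam M)) = {}" "subst 0 t (subst (Suc 0) t M) \<leadsto> R"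
  shows "share t (Lam (Lam M)) \<leadsto> R"
proof -
  have "share t (Lam (Lam M)) \<leadsto> App (App (Lam (Lam M)) t) t"
    using assms by (intro steps_share) auto
  also have "\<dots> \<leadsto> R"
    using assms by (intro steps_beta2) auto
  finally show ?thesis .
qed


subsection \<open>Unary programs on encoded argument lists\<close>

text \<open>A number is a right spine whose length is that number, so a tree recursion finds the
  result for the predecessor in its second recursive argument.\<close>

fun nat_tree :: "nat \<Rightarrow> 'c trm" where
  "nat_tree 0 = leaf"
| "nat_tree (Suc n) = node leaf (nat_tree n)"

fun list_tree :: "nat list \<Rightarrow> 'c trm" where
  "list_tree [] = leaf"
| "list_tree (x # xs) = node (nat_tree x) (list_tree xs)"

lemma tree_nat_tree [simp]: "tree (nat_tree n)"
  by (induction n) auto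

lemma tree_list_tree [simp]: "tree (list_tree xs)"
  by (induction xs) auto

text \<open>The result is a tree rather than a number, so that one notion covers programs returning
  numbers and programs returning lists.\<close>

definition computes :: "nat \<Rightarrow> (nat list \<Rightarrow> 'c trm) \<Rightarrow> 'c trm \<Rightarrow> bool" where
  "computes n f M \<longleftrightarrow> is_value M \<and> [] \<turnstile> M : T \<multimap> T \<and>
     (\<forall>xs. length xs = n \<longrightarrow> App M (list_tree xs) \<leadsto> f xs)"

lemma computesD:
  assumes "computes n f M"
  shows "is_value M" "fv M = {}" "E \<turnstile> M : T \<multimap> T"
    and "length xs = n \<Longrightarrow> App M (list_tree xs) \<leadsto> f xs"
  using assms by (auto simp: computes_def typed_Nil_iff intro: typed_closed)

lemma computes_Lam:
  assumes "[T] \<turnstile> M : T" "\<And>xs. length xs = n \<Longrightarrow> subst 0 (list_tree xs) M \<leadsto> f xs"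
  shows "computes n f (Lam M)"
  using assms by (auto simp: computes_def intro: typed_Lam steps_beta_value)

section \<open>Basic functions\<close>

lemma computes_zero: "computes n (\<lambda>xs. nat_tree 0) (Lam leaf)"
  by (rule computes_Lam) (auto intro: typed_leaf)

text \<open>The conditional extracts the head of the one-element list; its branch
  \<open>leaf\<close> is a dummy for the empty list.\<close>

lemma computes_succ:
  "computes 1 (\<lambda>xs. nat_tree (Suc (xs ! 0)))
     (Lam (node leaf (Cond (Var 0) [Lam (Lam (Var 1)), leaf])))"
proof (rule computes_Lam)
  show "[T] \<turnstile> node leaf (Cond (Var 0) [Lam (Lam (Var 1)), leaf]) : T"
    unfolding One_nat_def by (rule typed_rules | simp; fail)+
next
  fix xs :: "nat list"
  assume "length xs = 1"
  then obtain x where xs: "xs = [x]" by (auto simp: length_Suc_conv)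
  have "Cond (node (nat_tree x) leaf) [Lam (Lam (Var 1)), leaf] \<leadsto>
      App (App (Lam (Lam (Var 1))) (nat_tree x)) leaf"
    by (simp add: steps_Cond_node)
  also have "\<dots> \<leadsto> nat_tree x"
    by (rule steps_beta2) auto
  finally show "subst 0 (list_tree xs) (node leaf (Cond (Var 0) [Lam (Lam (Var 1)), leaf])) \<leadsto>
      nat_tree (Suc (xs ! 0))"
    by (auto simp: xs intro: steps_App)
qed

text \<open>Index \<open>0\<close> selects the head; a larger index passes the tail to the
  projection at the preceding index and arity.\<close>

lemma computes_proj: "i < n \<Longrightarrow> \<exists>M. computes n (\<lambda>xs. nat_tree (xs ! i)) M"
proof (induction i arbitrary: n)
  case 0
  have "computes n (\<lambda>xs. nat_tree (xs ! 0)) (Lam (Cond (Var 0) [Lam (Lam (Var 1)), leaf]))"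
  proof (rule computes_Lam)
    show "[T] \<turnstile> Cond (Var 0) [Lam (Lam (Var 1)), leaf] : T"
      unfolding One_nat_def by (rule typed_rules | simp; fail)+
  next
    fix xs :: "nat list"
    assume "length xs = n"
    with 0 obtain x ys where xs: "xs = x # ys" by (cases xs) auto
    have "Cond (list_tree xs) [Lam (Lam (Var 1)), leaf] \<leadsto>
        App (App (Lam (Lam (Var 1))) (nat_tree x)) (list_tree ys)"
      by (simp add: xs steps_Cond_node)
    also have "\<dots> \<leadsto> nat_tree x"
      by (rule steps_beta2) auto
    finally show "subst 0 (list_tree xs) (Cond (Var 0) [Lam (Lam (Var 1)), leaf]) \<leadsto>
        nat_tree (xs ! 0)"
      by (simp add: xs)
  qed
  then show ?case ..
next
  case (Suc i)
  then obtain m where n: "n = Suc m" "i < m" by (cases n) auto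
  with Suc.IH obtain M where M: "computes m (\<lambda>xs. nat_tree (xs ! i)) M" by blast
  note [simp] = computesD(2)[OF M]
  have "computes n (\<lambda>xs. nat_tree (xs ! Suc i))
      (Lam (App M (Cond (Var 0) [Lam (Lam (Var 0)), leaf])))"
  proof (rule computes_Lam)
    show "[T] \<turnstile> App M (Cond (Var 0) [Lam (Lam (Var 0)), leaf]) : T"
      by (rule computesD(3)[OF M] typed_rules | simp; fail)+
  next
    fix xs :: "nat list"
    assume "length xs = n"
    with n obtain x ys where xs: "xs = x # ys" "length ys = m" by (cases xs) auto
    have "Cond (list_tree xs) [Lam (Lam (Var 0)), leaf] \<leadsto>
        App (App (Lam (Lam (Var 0))) (nat_tree x)) (list_tree ys)"
      by (simp add: xs steps_Cond_node)
    also have "\<dots> \<leadsto> list_tree ys"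
      by (rule steps_beta2) auto
    finally have "App M (Cond (list_tree xs) [Lam (Lam (Var 0)), leaf]) \<leadsto> App M (list_tree ys)"
      by (intro steps_App) auto
    also have "\<dots> \<leadsto> nat_tree (xs ! Suc i)"
      using computesD(4)[OF M, of ys] xs by simp
    finally show "subst 0 (list_tree xs) (App M (Cond (Var 0) [Lam (Lam (Var 0)), leaf])) \<leadsto>
        nat_tree (xs ! Suc i)"
      by simp
  qed
  then show ?case ..
qed

section \<open>Closure under composition and primitive recursion\<close>

text \<open>Both \<open>g\<close> and the remaining functions consume the argument list, so it is
  shared between their programs.\<close>

lemma computes_map:
  assumes "\<forall>g \<in> set gs. \<exists>M. computes n (\<lambda>xs. nat_tree (g xs)) M"
  shows "\<exists>M. computes n (\<lambda>xs. list_tree (map (\<lambda>g. g xs) gs)) M"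
  using assms
proof (induction gs)
  case Nil
  have "computes n (\<lambda>xs. list_tree []) (Lam leaf)"
    by (rule computes_Lam) (auto intro: typed_leaf)
  then show ?case by auto
next
  case (Cons g gs)
  then obtain G L where G: "computes n (\<lambda>xs. nat_tree (g xs)) G"
    and L: "computes n (\<lambda>xs. list_tree (map (\<lambda>g. g xs) gs)) L"
    by auto
  note [simp] = computesD(2)[OF G] computesD(2)[OF L]
  have "computes n (\<lambda>xs. list_tree (map (\<lambda>g. g xs) (g # gs)))
      (Lam (share (Var 0) (Lam (Lam (node (App G (Var 1)) (App L (Var 0)))))))"
  proof (rule computes_Lam)
    show "[T] \<turnstile> share (Var 0) (Lam (Lam (node (App G (Var 1)) (App L (Var 0))))) : T"
      unfolding One_nat_def
      by (rule computesD(3)[OF G] computesD(3)[OF L] typed_share typed_rules | simp; fail)+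
  next
    fix xs :: "nat list"
    assume "length xs = n"
    then have "node (App G (list_tree xs)) (App L (list_tree xs)) \<leadsto>
        list_tree (map (\<lambda>g. g xs) (g # gs))"
      using computesD(4)[OF G] computesD(4)[OF L] by (auto intro: steps_App)
    then show "subst 0 (list_tree xs)
        (share (Var 0) (Lam (Lam (node (App G (Var 1)) (App L (Var 0)))))) \<leadsto>
        list_tree (map (\<lambda>g. g xs) (g # gs))"
      by (auto intro: steps_share_Lam)
  qed
  then show ?case by blast
qed

text \<open>The intermediate list is consumed once, so the two programs can simply be chained; any
  copying of the input happens inside \<open>L\<close>.\<close>

lemma computes_comp:
  assumes L: "computes n (\<lambda>xs. list_tree (g xs)) L" and F: "computes m f F"
    and len: "\<And>xs. length (g xs) = m"
  shows "computes n (\<lambda>xs. f (g xs)) (Lam (App F (App L (Var 0))))"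
proof (rule computes_Lam)
  note [simp] = computesD(2)[OF F] computesD(2)[OF L]
  show "[T] \<turnstile> App F (App L (Var 0)) : T"
    by (rule computesD(3)[OF F] computesD(3)[OF L] typed_rules | simp; fail)+
  fix xs :: "nat list"
  assume "length xs = n"
  then have "App F (App L (list_tree xs)) \<leadsto> App F (list_tree (g xs))"
    using computesD(4)[OF L] by (auto intro: steps_App)
  also have "\<dots> \<leadsto> f (g xs)"
    using computesD(4)[OF F] len by simp
  finally show "subst 0 (list_tree xs) (App F (App L (Var 0))) \<leadsto> f (g xs)" by simp
qed

lemma computes_prec:
  assumes G: "computes n (\<lambda>xs. nat_tree (g xs)) G"
    and H: "computes (Suc (Suc n)) (\<lambda>xs. nat_tree (h xs)) H"
  shows "\<exists>M. computes (Suc n)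
    (\<lambda>xs. nat_tree (rec_nat (g (tl xs)) (\<lambda>y r. h (y # r # tl xs)) (hd xs))) M"
proof -
  let ?f = "\<lambda>xs. rec_nat (g xs) (\<lambda>y r. h (y # r # xs))"
  note [simp] = computesD(2)[OF G] computesD(2)[OF H]
  \<comment> \<open>The five abstractions bind the left child, the predecessor, the two recursive
    results and the parameter list. Inside the continuation, \<open>Var 5\<close> is the
    predecessor, \<open>Var 3\<close> its recursive result, and \<open>Var 1\<close> and
    \<open>Var 0\<close> are the copies of the parameters.\<close>
  define S where "S = Lam (Lam (Lam (Lam (Lam (share (Var 0) (Lam (Lam
    (App H (node (Var 5) (node (App (Var 3) (Var 1)) (Var 0)))))))))))"
  have fv_S [simp]: "fv S = {}" by (simp add: S_def)
  have typed_S: "E \<turnstile> S : T \<multimap> T \<multimap> (T \<multimap> T) \<multimap> (T \<multimap> T) \<multimap> (T \<multimap> T)" for E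
    unfolding S_def eval_nat_numeral BitM.simps One_nat_def
    by (rule computesD(3)[OF H] typed_share typed_rules | simp; fail)+
  \<comment> \<open>The recursion at type \<open>T \<multimap> T\<close> is evaluated before
    parameters arrive, so a single value \<open>V\<close> has to serve all parameter lists.\<close>
  have R: "\<exists>V. is_value V \<and> fv V = {} \<and> Rec (nat_tree y) [S, G] \<leadsto> V \<and>
      (\<forall>xs. length xs = n \<longrightarrow> App V (list_tree xs) \<leadsto> nat_tree (?f xs y))" for y
  proof (induction y)
    case 0
    then show ?case
      using computesD[OF G] by (intro exI[of _ G]) (auto simp: steps_Rec_leaf)
  next
    case (Suc y)
    then obtain V where V: "is_value V" "fv V = {}" "Rec (nat_tree y) [S, G] \<leadsto> V"
      "\<And>xs. length xs = n \<Longrightarrow> App V (list_tree xs) \<leadsto> nat_tree (?f xs y)"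
      by blast
    define W where "W = Lam (share (Var 0) (Lam (Lam
      (App H (node (nat_tree y) (node (App V (Var 1)) (Var 0)))))))"
    have SW: "App (App (App (App S leaf) (nat_tree y)) L3) L4 \<leadsto> W" if "L3 \<leadsto> G" "L4 \<leadsto> V" for L3 L4
      unfolding S_def W_def using V computesD(1)[OF G]
      by (intro steps_beta4[OF _ _ _ _ that(1) _ _ that(2)]) auto
    have "Rec (nat_tree (Suc y)) [S, G] \<leadsto>
        App (App (App (App S leaf) (nat_tree y)) (Rec leaf [S, G])) (Rec (nat_tree y) [S, G])"
      by (simp add: steps_Rec_node)
    \<comment> \<open>The recursive result for the left leaf evaluates to \<open>G\<close>, as
      call-by-value requires, and is then discarded by \<open>S\<close>.\<close>
    also have "\<dots> \<leadsto> W"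
      using V(3) by (intro SW steps_Rec_leaf)
    finally have "Rec (nat_tree (Suc y)) [S, G] \<leadsto> W" .
    moreover have "App W (list_tree xs) \<leadsto> nat_tree (?f xs (Suc y))" if xs: "length xs = n" for xs
    proof -
      have "App H (node (nat_tree y) (node (App V (list_tree xs)) (list_tree xs))) \<leadsto>
          App H (list_tree (y # ?f xs y # xs))"
        using V(4)[OF xs] by (auto intro!: steps_App)
      also have "\<dots> \<leadsto> nat_tree (?f xs (Suc y))"
        using computesD(4)[OF H, of "y # ?f xs y # xs"] xs by simp
      finally show ?thesis
        unfolding W_def using V(2) by (auto intro!: steps_beta_value steps_share_Lam)
    qed
    ultimately show ?case
      using V by (intro exI[of _ W]) (auto simp: W_def)
  qed
  \<comment> \<open>The conditional separates the counter, at the head, from the parameters in the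
    tail, and applies the value of the recursion to the latter.\<close>
  have "computes (Suc n)
    (\<lambda>xs. nat_tree (rec_nat (g (tl xs)) (\<lambda>y r. h (y # r # tl xs)) (hd xs)))
    (Lam (Cond (Var 0) [Lam (Lam (App (Rec (Var 1) [S, G]) (Var 0))), leaf]))"
  proof (rule computes_Lam)
    show "[T] \<turnstile> Cond (Var 0) [Lam (Lam (App (Rec (Var 1) [S, G]) (Var 0))), leaf] : T"
      unfolding One_nat_def
      by (rule typed_S computesD(3)[OF G] typed_rules | simp; fail)+
  next
    fix xs :: "nat list"
    assume "length xs = Suc n"
    then obtain y ys where xs: "xs = y # ys" "length ys = n" by (cases xs) auto
    obtain V where V: "Rec (nat_tree y) [S, G] \<leadsto> V" "App V (list_tree ys) \<leadsto> nat_tree (?f ys y)"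
      using R[of y] xs by blast
    have "Cond (list_tree xs) [Lam (Lam (App (Rec (Var 1) [S, G]) (Var 0))), leaf] \<leadsto>
        App (App (Lam (Lam (App (Rec (Var 1) [S, G]) (Var 0)))) (nat_tree y)) (list_tree ys)"
      by (simp add: xs steps_Cond_node)
    also have "\<dots> \<leadsto> App (Rec (nat_tree y) [S, G]) (list_tree ys)"
      by (intro steps_beta2) auto
    also have "\<dots> \<leadsto> App V (list_tree ys)"
      using V by (intro steps_App) auto
    also note V(2)
    finally show "subst 0 (list_tree xs)
        (Cond (Var 0) [Lam (Lam (App (Rec (Var 1) [S, G]) (Var 0))), leaf]) \<leadsto>
        nat_tree (?f (tl xs) (hd xs))"
      by (simp add: xs)
  qed
  then show ?thesis by blast
qed

lemma computes_prim_recursive: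
  "prim_recursive n f \<Longrightarrow> \<exists>M. computes n (\<lambda>xs. nat_tree (f xs)) M"
proof (induction rule: prim_recursive.induct)
  case (zero n)
  show ?case using computes_zero by auto
next
  case succ
  show ?case using computes_succ by blast
next
  case (proj i n)
  then show ?case by (rule computes_proj)
next
  case (comp gs f n)
  from comp.IH obtain F where F: "computes (length gs) (\<lambda>xs. nat_tree (f xs)) F"
    by blast
  from comp.IH obtain L where L: "computes n (\<lambda>xs. list_tree (map (\<lambda>g. g xs) gs)) L"
    using computes_map[of gs n] by blast
  from computes_comp[OF L F] show ?case by auto
next
  case (prec n g h)
  then show ?case using computes_prec by blast
next
  \<comment> \<open>Only lists of length \<open>n\<close> matter for \<open>computes\<close>, and
    there \<open>f\<close> and \<open>f'\<close> agree.\<close>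
  case (ext n f f')
  then show ?case by (auto simp: computes_def)
qed


subsection \<open>Curried programs on unary numerals\<close>

abbreviation "num \<equiv> unary_numeral constrs U"

lemma num_simps [simp]: "num 0 = zero" "num (Suc n) = succ (num n)"
  by (simp_all add: constrs_U)

declare unary_numeral.simps [simp del]

lemma constructor_term_num: "constructor_term (num n)"
  by (induction n) (auto intro: constructor_term.intros)

lemma is_value_num [simp]: "is_value (num n)"
  by (simp add: constructor_term_num is_value.intros)

lemma fv_num [simp]: "fv (num n) = {}"
  by (induction n) auto

section \<open>Conversions between unary numerals and trees\<close>

definition num_to_tree :: "'c trm \<Rightarrow> 'c trm" where
  "num_to_tree L = Rec L [Lam (Lam (node leaf (Var 0))), leaf]"

text \<open>This measures the length of the right spine, which inverts the coding of
  numbers.\<close>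

definition tree_to_num :: "'c trm \<Rightarrow> 'c trm" where
  "tree_to_num L = Rec L [Lam (Lam (Lam (Lam (succ (Var 0))))), zero]"

lemma fv_conversions [simp]: "fv (num_to_tree L) = fv L" "fv (tree_to_num L) = fv L"
  by (simp_all add: num_to_tree_def tree_to_num_def)

lemma subst_conversions [simp]:
  "subst k V (num_to_tree L) = num_to_tree (subst k V L)"
  "subst k V (tree_to_num L) = tree_to_num (subst k V L)"
  by (simp_all add: num_to_tree_def tree_to_num_def)

lemma typed_num_to_tree: "E \<turnstile> L : N \<Longrightarrow> E \<turnstile> num_to_tree L : T"
  unfolding num_to_tree_def
  apply (rule typed_Rec_unary, assumption)
  apply (rule typed_rules | simp; fail)+
  done

lemma typed_tree_to_num: "E \<turnstile> L : T \<Longrightarrow> E \<turnstile> tree_to_num L : N"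
  unfolding tree_to_num_def
  apply (rule typed_Rec_tree, assumption)
  apply (rule typed_rules | simp; fail)+
  done

lemma steps_num_to_tree: "num_to_tree (num n) \<leadsto> nat_tree n"
proof (induction n)
  case 0
  show ?case by (simp add: num_to_tree_def steps_Rec_zero)
next
  case (Suc n)
  have "num_to_tree (num (Suc n)) \<leadsto>
      App (App (Lam (Lam (node leaf (Var 0)))) (num n)) (num_to_tree (num n))"
    by (simp add: num_to_tree_def steps_Rec_succ constructor_term_num)
  also have "\<dots> \<leadsto> App (App (Lam (Lam (node leaf (Var 0)))) (num n)) (nat_tree n)"
    using Suc by (intro steps_App) auto
  also have "\<dots> \<leadsto> nat_tree (Suc n)"
    by (intro steps_beta2) auto
  finally show ?case .
qed

lemma steps_tree_to_num: "tree_to_num (nat_tree n) \<leadsto> num n"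
proof (induction n)
  case 0
  show ?case by (simp add: tree_to_num_def steps_Rec_leaf)
next
  case (Suc n)
  have "tree_to_num (nat_tree (Suc n)) \<leadsto>
      App (App (App (App (Lam (Lam (Lam (Lam (succ (Var 0)))))) leaf) (nat_tree n))
        (tree_to_num leaf)) (tree_to_num (nat_tree n))"
    by (simp add: tree_to_num_def steps_Rec_node)
  also have "\<dots> \<leadsto> num (Suc n)"
  proof (rule steps_beta4)
    show "tree_to_num leaf \<leadsto> zero" by (simp add: tree_to_num_def steps_Rec_leaf)
    show "tree_to_num (nat_tree n) \<leadsto> num n" by fact
  qed (auto intro: is_value.intros constructor_term.intros)
  finally show ?case .
qed

section \<open>Collecting curried arguments into a list\<close>

text \<open>The first argument is a continuation expecting the list of the arguments still to come;
  each numeral read is absorbed into it, to be prepended to that list later.\<close>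

fun currying :: "nat \<Rightarrow> 'c trm" where
  "currying 0 = Lam (App (Var 0) leaf)"
| "currying (Suc n) = Lam (Lam (App (currying n)
     (Lam (App (Var 2) (node (num_to_tree (Var 1)) (Var 0))))))"

lemma fv_currying [simp]: "fv (currying n) = {}"
  by (induction n) auto

lemma typed_currying: "E \<turnstile> currying n : (T \<multimap> N) \<multimap> lollis N n N"
proof (induction n arbitrary: E)
  case 0
  show ?case
    unfolding currying.simps lollis.simps by (rule typed_rules | simp; fail)+
next
  case (Suc n)
  show ?case
    unfolding currying.simps lollis.simps eval_nat_numeral BitM.simps One_nat_def
    by (rule Suc.IH typed_num_to_tree typed_rules | simp; fail)+
qed

text \<open>Reading a numeral changes the continuation, so the induction ranges over all closed
  values \<open>V\<close>.\<close>

lemma steps_currying: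
  assumes "is_value V" "fv V = {}" "length xs = n"
  shows "apps (App (currying n) V) (map num xs) \<leadsto> App V (list_tree xs)"
  using assms
proof (induction n arbitrary: V xs)
  case 0
  then show ?case by (auto intro: steps_beta_value)
next
  case (Suc n)
  then obtain x ys where xs: "xs = x # ys" "length ys = n" by (cases xs) auto
  \<comment> \<open>The conversion of \<open>x\<close> stays suspended under the abstraction until
    the rest of the list is supplied.\<close>
  let ?W = "Lam (App V (node (num_to_tree (num x)) (Var 0)))"
  have "App (App (currying (Suc n)) V) (num x) \<leadsto> App (currying n) ?W"
    unfolding currying.simps using Suc.prems by (intro steps_beta2) auto
  then have "apps (App (currying (Suc n)) V) (map num xs) \<leadsto>
      apps (App (currying n) ?W) (map num ys)"
    using steps_apps[of constrs arity _ _ "map num ys"] by (simp add: xs del: currying.simps)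
  also have "\<dots> \<leadsto> App ?W (list_tree ys)"
    using Suc.prems xs by (intro Suc.IH) auto
  also have "\<dots> \<leadsto> App V (node (num_to_tree (num x)) (list_tree ys))"
    using Suc.prems by (intro steps_beta_value) auto
  also have "\<dots> \<leadsto> App V (list_tree xs)"
    by (auto simp: xs intro!: steps_App steps_num_to_tree)
  finally show ?case .
qed

lemma prim_recursive_representable:
  assumes "prim_recursive n f"
  shows "\<exists>M. H_empty constrs arity Map.empty M (lollis N n N) \<and> represents constrs arity U M n f"
proof -
  obtain F where F: "computes n (\<lambda>xs. nat_tree (f xs)) F"
    using computes_prim_recursive[OF assms] by blast
  note [simp] = computesD(2)[OF F]
  \<comment> \<open>The initial continuation runs \<open>F\<close> on the complete list and decodes
    the result.\<close>
  let ?V = "Lam (tree_to_num (App F (Var 0)))"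
  have "[] \<turnstile> App (currying n) ?V : lollis N n N"
    by (rule typed_currying typed_tree_to_num computesD(3)[OF F] typed_rules | simp; fail)+
  moreover have "apps (App (currying n) ?V) (map num xs) \<leadsto> num (f xs)" if xs: "length xs = n" for xs
  proof -
    have "apps (App (currying n) ?V) (map num xs) \<leadsto> App ?V (list_tree xs)"
      using xs by (intro steps_currying) auto
    also have "\<dots> \<leadsto> tree_to_num (App F (list_tree xs))"
      by (intro steps_beta_value) auto
    also have "\<dots> \<leadsto> tree_to_num (nat_tree (f xs))"
      unfolding tree_to_num_def using computesD(4)[OF F xs] by (rule steps_Rec)
    also have "\<dots> \<leadsto> num (f xs)"
      by (rule steps_tree_to_num)
    finally show ?thesis .
  qed
  ultimately show ?thesis
    unfolding typed_Nil_iff represents_def by blast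
qed

end

theorem theorem5:
  fixes constrs :: "'a::finite \<Rightarrow> 'c list"
    and arity :: "'c \<Rightarrow> nat"
    and U B C D :: 'a
    and n :: nat
    and f :: "nat list \<Rightarrow> nat"
  assumes "free_algebra_family constrs arity U B C D"
    and "prim_recursive n f"
  shows "\<exists>M. H_empty constrs arity Map.empty M (lollis (Base U 0) n (Base U 0)) \<and>
             represents constrs arity U M n f"
proof -
  from assms(1) have "map arity (constrs U) = [1, 0]" "map arity (constrs C) = [2, 0]"
    by (simp_all add: free_algebra_family_def)
  \<comment> \<open>The lists of arities also fix the number of constructors of each algebra, which
    can therefore be named.\<close>
  then obtain s z p e where "constrs U = [s, z]" "constrs C = [p, e]"
    "arity s = 1" "arity z = 0" "arity p = 2" "arity e = 0"
    by (auto simp: map_eq_Cons_conv)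
  then interpret tree_algebra constrs arity U C s z p e
    by unfold_locales
  show ?thesis using assms(2) by (rule prim_recursive_representable)
qed

end
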